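(* Let $G=(V,E)$ be a finite weakly connected directed graph without loops whose edge set is partitioned as $E=E_1\cup\cdots\cup E_p$ into pairwise disjoint classes. Fix $i$ and let $G_i=(V,E\cup R_i)$ be the projection of $G$ along direction $i$, where $R_i=\{(u,v):(v,u)\in E\setminus E_i\}$. Let $G^i_{co}=(V^i_{co},E^i_{co})$ be the condensation of $G_i$. Then there is a set $\bar E_i\subseteq E_i$ whose removal implies a maximal PFD of $G$ along direction $i$ and whose implied CCG is exactly $G^i_{co}$ (its vertices, as vertex sets, are the strongly connected components of $G_i$, and its edges are those of $G^i_{co}$).
   Context: Component connectivity graph (CCG) implied by the removal of a set $F\subseteq E_i$: the simple directed graph whose vertices are the weakly connected components (identified with their vertex sets) of $(V,E\setminus F)$, with an edge $(C,C')$ if and only if $C\ne C'$ and there is an edge $(v,u)\in F$ with $v\in C$, $u\in C'$. The removal of $F$ implies a PFD (physically feasible decomposition) along direction $i$ if this CCG is a directed acyclic graph. The removal of $F\subseteq E_i$ implies a maximal PFD along direction $i$ if it implies a PFD and every set $F'$ with $F\subseteq F'\subseteq E_i$ whose removal implies a PFD implies the same CCG as $F$. The condensation of a directed graph has the strongly connected components as vertices and an edge $(C,C')$, $C\neq C'$, whenever some edge of the graph goes from a vertex of $C$ to a vertex of $C'$. *)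

theory Defs
  imports "Graph_Theory.Digraph_Component" "HOL-Library.Disjoint_Sets"
begin

text \<open>
  Weakly connected components, as vertex sets: the library's \<open>connected\<close> is connectivity of the
  underlying undirected graph.
\<close>
definition weak_components :: "'a pair_pre_digraph \<Rightarrow> 'a set set" where
  "weak_components G = verts ` {H. pre_digraph.max_subgraph (with_proj G) connected H}"

definition strong_components :: "'a pair_pre_digraph \<Rightarrow> 'a set set" where
  "strong_components G = verts ` pre_digraph.sccs (with_proj G)"

definition condensation :: "'a pair_pre_digraph \<Rightarrow> 'a set pair_pre_digraph" where
  "condensation G =
    \<lparr> pverts = strong_components G,
      parcs = {(C, C'). C \<in> strong_components G \<and> C' \<in> strong_components G \<and> C \<noteq> C' \<and>
                 (\<exists>v\<in>C. \<exists>u\<in>C'. (v, u) \<in> parcs G)} \<rparr>"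

definition remove_arcs :: "'a pair_pre_digraph \<Rightarrow> 'a rel \<Rightarrow> 'a pair_pre_digraph" where
  "remove_arcs G F = \<lparr> pverts = pverts G, parcs = parcs G - F \<rparr>"

text \<open>The component connectivity graph implied by the removal of \<open>F\<close>.\<close>
definition ccg :: "'a pair_pre_digraph \<Rightarrow> 'a rel \<Rightarrow> 'a set pair_pre_digraph" where
  "ccg G F =
    \<lparr> pverts = weak_components (remove_arcs G F),
      parcs = {(C, C'). C \<in> weak_components (remove_arcs G F) \<and>
                 C' \<in> weak_components (remove_arcs G F) \<and> C \<noteq> C' \<and>
                 (\<exists>v\<in>C. \<exists>u\<in>C'. (v, u) \<in> F)} \<rparr>"

text \<open>
  Below, a direction is represented by its class \<open>D\<close> of arcs. PFD stands for physically feasible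
  decomposition.
\<close>
definition implies_pfd :: "'a pair_pre_digraph \<Rightarrow> 'a rel \<Rightarrow> 'a rel \<Rightarrow> bool" where
  "implies_pfd G D F \<longleftrightarrow> F \<subseteq> D \<and> acyclic (parcs (ccg G F))"

definition implies_maximal_pfd :: "'a pair_pre_digraph \<Rightarrow> 'a rel \<Rightarrow> 'a rel \<Rightarrow> bool" where
  "implies_maximal_pfd G D F \<longleftrightarrow>
    implies_pfd G D F \<and>
    (\<forall>F'. F \<subseteq> F' \<and> F' \<subseteq> D \<and> implies_pfd G D F' \<longrightarrow> ccg G F' = ccg G F)"

definition projection :: "'a pair_pre_digraph \<Rightarrow> 'a rel \<Rightarrow> 'a pair_pre_digraph" where
  "projection G D =
    \<lparr> pverts = pverts G, parcs = parcs G \<union> {(u, v). (v, u) \<in> parcs G - D} \<rparr>"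

end

theory Submission
  imports Defs
begin

text \<open>
  Remove exactly those arcs of the direction that join different strongly connected components of
  the projection. An arc that is kept has both ends in one strong component: inside the direction by
  choice, outside it because the projection contains its reverse. Conversely, a closed walk of the
  projection stays in one strong component and so uses only kept arcs and their reverses. Hence the
  weak components after the removal are the strong components of the projection.

  For maximality, let a larger removal set imply a PFD. Each arc of the projection either
  stays in a weak component or is an arc of the CCG, so walks of the projection map to walks of the
  CCG; as the latter is acyclic, no strong component of the projection is split.
\<close>

section \<open>Weak components as classes of undirected reachability\<close>

definition weak_class :: "'a pair_pre_digraph \<Rightarrow> 'a \<Rightarrow> 'a set" where
  "weak_class G v = {u. (v, u) \<in> (parcs G \<union> (parcs G)\<inverse>)\<^sup>*}"

lemma weak_class_refl: "v \<in> weak_class G v"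
  by (simp add: weak_class_def)

lemma weak_class_eq_iff: "weak_class G u = weak_class G v \<longleftrightarrow> u \<in> weak_class G v"
proof -
  have "sym ((parcs G \<union> (parcs G)\<inverse>)\<^sup>*)"
    by (intro sym_rtrancl sym_Un_converse)
  then show ?thesis
    unfolding weak_class_def by (auto dest: symD intro: rtrancl_trans)
qed

lemma parcs_mk_symmetric_with_proj:
  "parcs (mk_symmetric (with_proj G)) = parcs G \<union> (parcs G)\<inverse>"
  by (force simp: mk_symmetric_def)

context pair_wf_digraph
begin

text \<open>Library reachability requires its endpoints to be vertices, whereas the reflexive
  closure relates every element to itself; hence the assumption on \<open>v\<close>.\<close>

lemma weak_class_conv_reachable:
  assumes "v \<in> pverts G"
  shows "u \<in> weak_class G v \<longleftrightarrow> v \<rightarrow>\<^sup>*\<^bsub>with_proj (mk_symmetric (with_proj G))\<^esub> u"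
proof -
  interpret S: pair_wf_digraph "mk_symmetric (with_proj G)"
    using wellformed_mk_symmetric by simp
  show ?thesis
    using assms S.reachable_conv'[of v u]
    by (auto simp: weak_class_def parcs_mk_symmetric_with_proj)
qed

lemma weak_class_subset:
  assumes "v \<in> pverts G"
  shows "weak_class G v \<subseteq> pverts G"
proof
  fix u assume "u \<in> weak_class G v"
  then have "(v, u) \<in> (parcs G \<union> (parcs G)\<inverse>)\<^sup>*" by (simp add: weak_class_def)
  then show "u \<in> pverts G"
    by (induction) (auto simp: assms wellformed')
qed

text \<open>Every initial piece of an undirected walk from \<open>v\<close> ends inside the class,
  so the walk survives restriction to the class; by symmetry any two members are joined through
  \<open>v\<close>.\<close>

lemma connected_induce_weak_class:
  assumes "v \<in> pverts G"
  shows "connected (with_proj G \<restriction> weak_class G v)"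
proof -
  let ?C = "weak_class G v"
  let ?H = "with_proj G \<restriction> ?C"
  interpret H: wf_digraph ?H by (rule wellformed_induce_subgraph)
  interpret S: pair_wf_digraph "mk_symmetric ?H" by (rule H.wellformed_mk_symmetric)
  have from_v: "(v, u) \<in> (parcs (mk_symmetric ?H))\<^sup>*"
    if "(v, u) \<in> (parcs G \<union> (parcs G)\<inverse>)\<^sup>*" for u
    using that
  proof induction
    case (step y z)
    then have "y \<in> ?C" "z \<in> ?C"
      by (auto simp: weak_class_def intro: rtrancl_into_rtrancl)
    with step.hyps have "(y, z) \<in> parcs (mk_symmetric ?H)"
      by (force simp: mk_symmetric_def)
    with step.IH show ?case by simp
  qed simp
  have "sym (parcs (mk_symmetric ?H))"
    by (auto simp: mk_symmetric_def intro!: symI)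
  then have "sym ((parcs (mk_symmetric ?H))\<^sup>*)" by (rule sym_rtrancl)
  then have "(u, w) \<in> (parcs (mk_symmetric ?H))\<^sup>*" if "u \<in> ?C" "w \<in> ?C" for u w
    using that from_v[of u] from_v[of w]
    by (auto simp: weak_class_def dest: symD intro: rtrancl_trans)
  then show ?thesis
    unfolding connected_def strongly_connected_def
    using weak_class_refl[of v G] by (auto simp: S.reachable_conv)
qed

lemma connected_subgraph_subset_weak_class:
  assumes "subgraph H (with_proj G)" "connected H" "v \<in> verts H"
  shows "verts H \<subseteq> weak_class G v"
proof
  fix u assume "u \<in> verts H"
  with assms have "v \<rightarrow>\<^sup>*\<^bsub>with_proj (mk_symmetric H)\<^esub> u"
    by (auto simp: connected_def strongly_connected_def)
  then have "v \<rightarrow>\<^sup>*\<^bsub>with_proj (mk_symmetric (with_proj G))\<^esub> u"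
    using assms(1) by (blast intro: pre_digraph.reachable_mono subgraph_mk_symmetric)
  moreover have "v \<in> pverts G" using assms by (auto simp: subgraph_def)
  ultimately show "u \<in> weak_class G v"
    by (simp add: weak_class_conv_reachable)
qed

lemma subgraph_induce_weak_class:
  assumes "v \<in> pverts G"
  shows "subgraph (with_proj G \<restriction> weak_class G v) (with_proj G)"
  using induced_induce[of "weak_class G v"] weak_class_subset[OF assms]
  by (simp add: induced_imp_subgraph)

text \<open>The upper bound needed for maximality: the subgraph induced by the class is the largest
  connected one containing \<open>v\<close>.\<close>

lemma connected_subgraph_induce_weak_class:
  assumes "subgraph H (with_proj G)" "connected H" "v \<in> verts H"
  shows "subgraph H (with_proj G \<restriction> weak_class G v)"
  using connected_subgraph_subset_weak_class[OF assms] assms(1)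
  by (auto simp: subgraph_def compatible_def wellformed_induce_subgraph
      dest: wf_digraph.tail_in_verts wf_digraph.head_in_verts)

text \<open>Replaces maximal connected subgraphs by closures of a relation, so that later arguments
  can use induction along walks.\<close>

lemma weak_components_conv: "weak_components G = weak_class G ` pverts G"
proof (intro equalityI subsetI)
  fix C assume "C \<in> weak_components G"
  then obtain H where H: "max_subgraph connected H" "C = verts H"
    by (auto simp: weak_components_def)
  then have sub: "subgraph H (with_proj G)" and con: "connected H"
    by (auto simp: max_subgraph_def)
  from con obtain v where v: "v \<in> verts H"
    by (auto simp: connected_def strongly_connected_def)
  with sub have vG: "v \<in> pverts G" by (auto simp: subgraph_def)
  have "with_proj G \<restriction> weak_class G v = H"
    using H(1) connected_subgraph_induce_weak_class[OF sub con v]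
      subgraph_induce_weak_class[OF vG] connected_induce_weak_class[OF vG]
    unfolding max_subgraph_def by blast
  then have "verts H = weak_class G v" by (metis induce_subgraph_verts)
  with H(2) vG show "C \<in> weak_class G ` pverts G" by blast
next
  fix C assume "C \<in> weak_class G ` pverts G"
  then obtain v where v: "v \<in> pverts G" and C: "C = weak_class G v" by blast
  let ?H = "with_proj G \<restriction> weak_class G v"
  have "H' = ?H" if "subgraph ?H H'" "subgraph H' (with_proj G)" "connected H'" for H'
  proof -
    have "v \<in> verts H'"
      using that(1) weak_class_refl[of v G] by (auto simp: subgraph_def)
    then have "subgraph H' ?H"
      using that connected_subgraph_induce_weak_class by blast
    \<comment> \<open>Subgraphs share the tail and head maps, so mutual inclusion yields equality of
      the whole records.\<close>
    with that(1) show ?thesis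
      by (intro pre_digraph.equality) (auto simp: subgraph_def compatible_def)
  qed
  then have "max_subgraph connected ?H"
    using subgraph_induce_weak_class[OF v] connected_induce_weak_class[OF v]
    unfolding max_subgraph_def by blast
  then have "verts ?H \<in> weak_components G"
    unfolding weak_components_def by blast
  then show "C \<in> weak_components G" by (simp add: C)
qed

section \<open>Strong components and acyclicity of the condensation\<close>

lemma strong_components_conv: "strong_components G = scc_of ` pverts G"
  using sccs_verts_conv sccs_verts_conv_scc_of by (simp add: strong_components_def)

lemma scc_of_conv:
  assumes "v \<in> pverts G"
  shows "scc_of v = {u. (v, u) \<in> (parcs G)\<^sup>* \<and> (u, v) \<in> (parcs G)\<^sup>*}"
proof -
  have "u \<in> pverts G" if "(v, u) \<in> (parcs G)\<^sup>*" for u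
    using that by induction (auto simp: assms wellformed')
  then show ?thesis
    using assms by (auto simp: scc_of_def reachable_conv)
qed

text \<open>Members of one component reach each other, so walks between components lift to walks
  between arbitrarily chosen members. A cycle would thus make two distinct components mutually
  reachable.\<close>

lemma acyclic_condensation: "acyclic (parcs (condensation G))"
proof (rule acyclicI, rule allI, rule notI)
  let ?r = "parcs (condensation G)"
  have comp: "\<exists>v\<in>pverts G. C = scc_of v" if "C \<in> strong_components G" for C
    using that by (auto simp: strong_components_conv)
  have connect: "c \<rightarrow>\<^sup>*\<^bsub>with_proj G\<^esub> d" if "C \<in> strong_components G" "c \<in> C" "d \<in> C" for C c d
    using comp[OF that(1)] that(2,3) by (auto simp: scc_of_def intro: reachable_trans)
  have arc: "c \<rightarrow>\<^sup>*\<^bsub>with_proj G\<^esub> d" if "(C, D) \<in> ?r" "c \<in> C" "d \<in> D" for C D c d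
  proof -
    from that obtain v u where vu: "v \<in> C" "u \<in> D" "(v, u) \<in> parcs G"
      and "C \<in> strong_components G" "D \<in> strong_components G"
      by (auto simp: condensation_def)
    then have "c \<rightarrow>\<^sup>*\<^bsub>with_proj G\<^esub> v" "u \<rightarrow>\<^sup>*\<^bsub>with_proj G\<^esub> d" using connect that by blast+
    moreover have "v \<rightarrow>\<^sup>*\<^bsub>with_proj G\<^esub> u" using vu(3) by (rule reachable_adjI)
    ultimately show ?thesis by (blast intro: reachable_trans)
  qed
  have path: "c \<rightarrow>\<^sup>*\<^bsub>with_proj G\<^esub> d" if "(C, D) \<in> ?r\<^sup>*" "C \<in> strong_components G" "c \<in> C" "d \<in> D" for C D c d
    using that
  proof (induction arbitrary: d)
    case base
    then show ?case by (intro connect)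
  next
    case (step D D')
    \<comment> \<open>The tail of an arc of \<open>G\<close> behind the step from \<open>D\<close>
      to \<open>D'\<close> shows that \<open>D\<close> is nonempty; the two walks are joined
      there.\<close>
    then obtain e where e: "e \<in> D" by (auto simp: condensation_def)
    then have "c \<rightarrow>\<^sup>*\<^bsub>with_proj G\<^esub> e" using step by blast
    also have "e \<rightarrow>\<^sup>*\<^bsub>with_proj G\<^esub> d" using arc[OF step.hyps(2) e] step.prems by blast
    finally show ?case .
  qed
  fix C assume "(C, C) \<in> ?r\<^sup>+"
  \<comment> \<open>Splitting off the first arc of the cycle gives a component different from
    \<open>C\<close>.\<close>
  then obtain D where CD: "(C, D) \<in> ?r" and DC: "(D, C) \<in> ?r\<^sup>*"
    by (auto dest: tranclD)
  then have ne: "C \<noteq> D" and sc: "C \<in> strong_components G" "D \<in> strong_components G"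
    by (auto simp: condensation_def)
  obtain c d where c: "c \<in> pverts G" "C = scc_of c" and d: "d \<in> pverts G" "D = scc_of d"
    using sc comp by blast
  have "c \<in> C" "d \<in> D" using c d by (auto intro: in_scc_of_self)
  then have "c \<rightarrow>\<^sup>*\<^bsub>with_proj G\<^esub> d" "d \<rightarrow>\<^sup>*\<^bsub>with_proj G\<^esub> c" using arc[OF CD] path[OF DC sc(2)] by blast+
  then have "d \<in> scc_of c" by (simp add: scc_of_def)
  then show False using scc_of_eq c d ne by blast
qed

section \<open>Arc removal and projection along a direction\<close>

lemma pair_wf_digraph_remove_arcs: "pair_wf_digraph (remove_arcs G F)"
  by unfold_locales (auto simp: remove_arcs_def wellformed')

lemma pair_wf_digraph_projection: "pair_wf_digraph (projection G D)"
  by unfold_locales (auto simp: projection_def wellformed')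

lemma weak_components_remove_arcs:
  "weak_components (remove_arcs G F) = weak_class (remove_arcs G F) ` pverts G"
  using pair_wf_digraph.weak_components_conv[OF pair_wf_digraph_remove_arcs]
  by (simp add: remove_arcs_def)

lemma strong_components_projection:
  "strong_components (projection G D) = pre_digraph.scc_of (with_proj (projection G D)) ` pverts G"
  using pair_wf_digraph.strong_components_conv[OF pair_wf_digraph_projection]
  by (simp add: projection_def)

end

section \<open>The witness and its implied CCG\<close>

definition inter_scc_arcs :: "'a pair_pre_digraph \<Rightarrow> 'a rel \<Rightarrow> 'a rel" where
  "inter_scc_arcs G D =
    {(v, u) \<in> D. \<not> ((v, u) \<in> (parcs (projection G D))\<^sup>* \<and> (u, v) \<in> (parcs (projection G D))\<^sup>*)}"

context pair_wf_digraph
begin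

lemma weak_class_remove_inter_scc_arcs:
  assumes "D \<subseteq> parcs G" "v \<in> pverts G"
  shows "weak_class (remove_arcs G (inter_scc_arcs G D)) v =
    pre_digraph.scc_of (with_proj (projection G D)) v"
proof -
  let ?P = "parcs (projection G D)"
  let ?F = "inter_scc_arcs G D"
  let ?W = "(parcs G - ?F) \<union> (parcs G - ?F)\<inverse>"
  interpret P: pair_wf_digraph "projection G D" by (rule pair_wf_digraph_projection)
  have arcs: "?P = parcs G \<union> (parcs G - D)\<inverse>" by (auto simp: projection_def)
  have "(v, u) \<in> ?W\<^sup>* \<longleftrightarrow> (v, u) \<in> ?P\<^sup>* \<and> (u, v) \<in> ?P\<^sup>*" for u
  proof
    assume "(v, u) \<in> ?W\<^sup>*"
    then show "(v, u) \<in> ?P\<^sup>* \<and> (u, v) \<in> ?P\<^sup>*"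
    proof induction
      case (step y z)
      have "(a, b) \<in> ?P\<^sup>* \<and> (b, a) \<in> ?P\<^sup>*" if "(a, b) \<in> parcs G - ?F" for a b
        using that by (cases "(a, b) \<in> D") (auto simp: inter_scc_arcs_def arcs)
      then have "(y, z) \<in> ?P\<^sup>* \<and> (z, y) \<in> ?P\<^sup>*" using step.hyps(2) by blast
      with step.IH show ?case by (auto intro: rtrancl_trans)
    qed simp
  next
    assume "(v, u) \<in> ?P\<^sup>* \<and> (u, v) \<in> ?P\<^sup>*"
    then have "(v, u) \<in> ?P\<^sup>*" "(u, v) \<in> ?P\<^sup>*" by auto
    then show "(v, u) \<in> ?W\<^sup>*"
    proof induction
      case (step y z)
      \<comment> \<open>The return walk to \<open>v\<close> is carried through the induction: an arc
        into \<open>z\<close> followed by the return from \<open>z\<close> is a return from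
        \<open>y\<close>.\<close>
      then have yv: "(y, v) \<in> ?P\<^sup>*" by (auto intro: converse_rtrancl_into_rtrancl)
      have "(z, y) \<in> ?P\<^sup>*" using step by (auto intro: rtrancl_trans)
      \<comment> \<open>The arc lies on a closed walk, so if it belongs to \<open>G\<close> it is
        kept; otherwise its reverse lies outside \<open>D\<close> and is kept.\<close>
      then have "(y, z) \<in> ?W"
        using step.hyps(2) by (auto simp: inter_scc_arcs_def arcs)
      then show ?case using step.IH[OF yv] by (rule rtrancl_into_rtrancl[rotated])
    qed simp
  qed
  then show ?thesis
    using P.scc_of_conv[of v] assms(2)
    by (simp add: weak_class_def remove_arcs_def) (simp add: projection_def)
qed

text \<open>A projection arc coming from outside \<open>D\<close> occurs in both orientations and so
  stays in one strong component. Between different components only arcs of \<open>D\<close> remain,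
  and exactly these are removed.\<close>

lemma ccg_inter_scc_arcs:
  assumes "D \<subseteq> parcs G"
  shows "ccg G (inter_scc_arcs G D) = condensation (projection G D)"
proof -
  let ?P = "parcs (projection G D)"
  interpret P: pair_wf_digraph "projection G D" by (rule pair_wf_digraph_projection)
  have comps: "weak_components (remove_arcs G (inter_scc_arcs G D)) = strong_components (projection G D)"
    using weak_class_remove_inter_scc_arcs[OF assms]
    by (simp add: weak_components_remove_arcs strong_components_projection)
  have "(v, u) \<in> inter_scc_arcs G D \<longleftrightarrow> (v, u) \<in> ?P"
    if C: "C \<in> strong_components (projection G D)" "C' \<in> strong_components (projection G D)"
      "C \<noteq> C'" and vu: "v \<in> C" "u \<in> C'" for C C' v u
  proof -
    obtain a b where a: "a \<in> pverts G" "C = P.scc_of a" and b: "b \<in> pverts G" "C' = P.scc_of b"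
      using C by (auto simp: strong_components_projection)
    have "P.scc_of v = C" "P.scc_of u = C'"
      using a b vu P.scc_of_eq by auto
    then have "u \<notin> P.scc_of v" using C(3) P.scc_of_eq by blast
    moreover have "v \<in> pverts (projection G D)"
      using vu(1) a by (auto simp: P.scc_of_def dest: P.reachable_in_verts)
    ultimately have "\<not> ((v, u) \<in> ?P\<^sup>* \<and> (u, v) \<in> ?P\<^sup>*)"
      using P.scc_of_conv[of v] by simp
    then show ?thesis
      using assms by (auto simp: inter_scc_arcs_def projection_def)
  qed
  then have "(\<exists>v\<in>C. \<exists>u\<in>C'. (v, u) \<in> inter_scc_arcs G D) \<longleftrightarrow> (\<exists>v\<in>C. \<exists>u\<in>C'. (v, u) \<in> ?P)"
    if "C \<in> strong_components (projection G D)" "C' \<in> strong_components (projection G D)"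
      "C \<noteq> C'" for C C'
    using that by blast
  then show ?thesis
    by (simp add: ccg_def condensation_def comps cong: conj_cong)
qed

section \<open>Maximality\<close>

lemma projection_path_imp_ccg_path:
  assumes "F \<subseteq> D" "v \<in> pverts G" "(v, u) \<in> (parcs (projection G D))\<^sup>*"
  shows "(weak_class (remove_arcs G F) v, weak_class (remove_arcs G F) u) \<in> (parcs (ccg G F))\<^sup>*"
  using assms(3)
proof induction
  case (step y z)
  let ?c = "weak_class (remove_arcs G F)"
  have yz: "y \<in> pverts G" "z \<in> pverts G"
    using step.hyps(2) by (auto simp: projection_def wellformed')
  have "?c y = ?c z \<or> (?c y, ?c z) \<in> parcs (ccg G F)"
  proof (cases "(y, z) \<in> F")
    case True
    then show ?thesis
      using yz weak_class_refl[of y] weak_class_refl[of z]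
      by (auto simp: ccg_def weak_components_remove_arcs)
  next
    case False
    \<comment> \<open>An arc added by the projection reverses one outside \<open>D\<close>, hence
      outside \<open>F\<close>, so the original is still present.\<close>
    then have "(z, y) \<in> parcs (remove_arcs G F) \<union> (parcs (remove_arcs G F))\<inverse>"
      using step.hyps(2) assms(1) by (auto simp: projection_def remove_arcs_def)
    then have "y \<in> ?c z" unfolding weak_class_def by blast
    then show ?thesis by (simp add: weak_class_eq_iff)
  qed
  with step.IH show ?case by auto
qed simp

text \<open>Removing more arcs can only shrink a class. It does not shrink here: mutually reachable
  vertices of the projection have classes that reach each other in an acyclic CCG, hence equal
  classes.\<close>

lemma weak_class_remove_arcs_pfd:
  assumes "D \<subseteq> parcs G" "inter_scc_arcs G D \<subseteq> F" "implies_pfd G D F" "v \<in> pverts G"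
  shows "weak_class (remove_arcs G F) v = weak_class (remove_arcs G (inter_scc_arcs G D)) v"
proof
  have "parcs G - F \<union> (parcs G - F)\<inverse> \<subseteq>
      parcs G - inter_scc_arcs G D \<union> (parcs G - inter_scc_arcs G D)\<inverse>"
    using assms(2) by auto
  from rtrancl_mono[OF this]
  show "weak_class (remove_arcs G F) v \<subseteq> weak_class (remove_arcs G (inter_scc_arcs G D)) v"
    by (auto simp: weak_class_def remove_arcs_def)
  interpret P: pair_wf_digraph "projection G D" by (rule pair_wf_digraph_projection)
  let ?c = "weak_class (remove_arcs G F)"
  have FD: "F \<subseteq> D" and acyc: "acyclic (parcs (ccg G F))"
    using assms(3) by (auto simp: implies_pfd_def)
  show "weak_class (remove_arcs G (inter_scc_arcs G D)) v \<subseteq> ?c v"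
  proof
    fix u assume "u \<in> weak_class (remove_arcs G (inter_scc_arcs G D)) v"
    then have u: "u \<in> P.scc_of v"
      using weak_class_remove_inter_scc_arcs[OF assms(1,4)] by simp
    then have "u \<in> pverts (projection G D)"
      by (auto simp: P.scc_of_def dest: P.reachable_in_verts)
    then have "u \<in> pverts G" by (simp add: projection_def)
    moreover have "(v, u) \<in> (parcs (projection G D))\<^sup>*" "(u, v) \<in> (parcs (projection G D))\<^sup>*"
      using u P.scc_of_conv[of v] assms(4) by (auto simp: projection_def)
    ultimately have "(?c v, ?c u) \<in> (parcs (ccg G F))\<^sup>*" "(?c u, ?c v) \<in> (parcs (ccg G F))\<^sup>*"
      using projection_path_imp_ccg_path[OF FD] assms(4) by auto
    then have "?c u = ?c v"
      using acyclic_impl_antisym_rtrancl[OF acyc] by (auto dest: antisymD)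
    then show "u \<in> ?c v" by (simp add: weak_class_eq_iff)
  qed
qed

text \<open>Equal components do not suffice, since CCG arcs are read off the removed set. The
  additional arcs of \<open>F\<close> have both ends in one strong component and so contribute no
  CCG arc.\<close>

lemma ccg_eq_of_pfd:
  assumes "D \<subseteq> parcs G" "inter_scc_arcs G D \<subseteq> F" "implies_pfd G D F"
  shows "ccg G F = ccg G (inter_scc_arcs G D)"
proof -
  let ?F = "inter_scc_arcs G D"
  interpret P: pair_wf_digraph "projection G D" by (rule pair_wf_digraph_projection)
  have comps: "weak_components (remove_arcs G F) = weak_components (remove_arcs G ?F)"
    using weak_class_remove_arcs_pfd[OF assms] by (simp add: weak_components_remove_arcs)
  have FD: "F \<subseteq> D" using assms(3) by (simp add: implies_pfd_def)
  have "(v, u) \<in> F \<longleftrightarrow> (v, u) \<in> ?F"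
    if C: "C \<in> weak_components (remove_arcs G ?F)" "C' \<in> weak_components (remove_arcs G ?F)"
      "C \<noteq> C'" and vu: "v \<in> C" "u \<in> C'" for C C' v u
  proof
    assume vuF: "(v, u) \<in> F"
    then have "(v, u) \<in> D" "v \<in> pverts G"
      using FD assms(1) by (auto simp: wellformed')
    moreover have "u \<notin> P.scc_of v"
    proof -
      obtain a b where "C = weak_class (remove_arcs G ?F) a" "C' = weak_class (remove_arcs G ?F) b"
        using C(1,2) unfolding weak_components_remove_arcs by blast
      with vu have "C = weak_class (remove_arcs G ?F) v" "C' = weak_class (remove_arcs G ?F) u"
        by (simp_all add: weak_class_eq_iff[symmetric])
      with C(3) have "u \<notin> weak_class (remove_arcs G ?F) v"
        by (simp add: weak_class_eq_iff[symmetric])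
      then show ?thesis
        by (simp add: weak_class_remove_inter_scc_arcs[OF assms(1) \<open>v \<in> pverts G\<close>])
    qed
    ultimately show "(v, u) \<in> ?F"
      using P.scc_of_conv[of v] by (auto simp: inter_scc_arcs_def projection_def)
  qed (use assms(2) in blast)
  then have "(\<exists>v\<in>C. \<exists>u\<in>C'. (v, u) \<in> F) \<longleftrightarrow> (\<exists>v\<in>C. \<exists>u\<in>C'. (v, u) \<in> ?F)"
    if "C \<in> weak_components (remove_arcs G ?F)" "C' \<in> weak_components (remove_arcs G ?F)"
      "C \<noteq> C'" for C C'
    using that by blast
  then show ?thesis
    by (simp add: ccg_def comps cong: conj_cong)
qed

lemma inter_scc_arcs_maximal_pfd:
  assumes "D \<subseteq> parcs G"
  shows "implies_maximal_pfd G D (inter_scc_arcs G D)"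
proof -
  have "inter_scc_arcs G D \<subseteq> D" by (auto simp: inter_scc_arcs_def)
  moreover have "acyclic (parcs (ccg G (inter_scc_arcs G D)))"
    using pair_wf_digraph.acyclic_condensation[OF pair_wf_digraph_projection]
    by (simp add: ccg_inter_scc_arcs[OF assms])
  ultimately show ?thesis
    using ccg_eq_of_pfd[OF assms] by (simp add: implies_maximal_pfd_def implies_pfd_def)
qed

end

theorem theorem4:
  fixes G :: "'a pair_pre_digraph" and E :: "nat \<Rightarrow> 'a rel" and p i :: nat
  assumes "pair_digraph G"
    and "Digraph_Component.connected (with_proj G)"
    and "parcs G = (\<Union>j\<in>{1..p}. E j)"
    and "disjoint_family_on E {1..p}"
    and "i \<in> {1..p}"
  shows "\<exists>F. F \<subseteq> E i \<and> implies_maximal_pfd G (E i) F \<and>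
           ccg G F = condensation (projection G (E i))"
proof -
  interpret pair_digraph G by fact
  have "E i \<subseteq> parcs G" using assms(3,5) by blast
  then show ?thesis
    using inter_scc_arcs_maximal_pfd ccg_inter_scc_arcs
    by (intro exI[of _ "inter_scc_arcs G (E i)"]) (auto simp: inter_scc_arcs_def)
qed

end
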